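(* Let $A, B \subset \mathbb{R}^n$ be non-empty compact sets and let a uniform grid with spacing $h>0$ be given which covers $A \cup B$ and which is suitable for $A$ and suitable for $B$. Define the dimensional constant $$\Delta_n = \sup_{y \in Q} \min\Big( |y|, \ \min_{x \in N'} 2|x-y| \Big),$$ where $Q = \{ y \in \mathbb{R}^n : 0 \le y_i \le 1 \text{ for all } i = 1,\dots,n\}$ and $N' = \{ x \in \mathbb{R}^n : x_i \in \{0,1\} \text{ for all } i=1,\dots,n \} \setminus \{0\}$. Then the approximation error $\delta = d_H(A,B) - \tilde{d}(A,B)$ satisfies $$\delta \le \Delta_n \cdot h.$$
   Context: $|\cdot|$ is the Euclidean norm on $\mathbb{R}^n$. For a set $\Omega \subset \mathbb{R}^n$, $d_\Omega(x) = \inf_{y \in \Omega} |x-y|$. The Hausdorff distance is $d_H(A,B) = \max(d(A \to B), d(B \to A))$ with $d(A \to B) = \sup_{x \in A} \inf_{y \in B} |x-y|$. Grid: a bounded rectangular grid in $\mathbb{R}^n$ with uniform spacing $h>0$ in each dimension, i.e. $N = \{p + h j : j \in \mathbb{Z}^n,\ 0 \le j_i \le K_i \text{ for } i=1,\dots,n\}$ for some $p \in \mathbb{R}^n$ and integers $K_i \ge 1$, is the finite set of grid points. $C$ is the finite set of grid cells; for $c \in C$, $N(c) \subset N$ is the set of the $2^n$ corners of $c$ (a cube of side length $h$), and $\mathrm{co}(N(c))$ is their convex hull. The grid covers $A\cup B$ if for each $y \in A \cup B$ there is $c \in C$ with $y \in \mathrm{co}(N(c))$. The grid is called suitable for $A$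 if for every cell $c \in C$ such that $x \notin A$ for all corners $x \in N(c)$, one has $\mathrm{co}(N(c)) \cap A = \emptyset$; similarly for $B$. The grid approximation of the Hausdorff distance is $\tilde{d}(A,B) = \max_{x \in N} |d_A(x) - d_B(x)|$. *)

theory Defs
  imports "HOL-Analysis.Analysis"
begin

text \<open>The distance from a point to a set is \<^const>\<open>infdist\<close>, which is the
  infimum of the distances for non-empty sets and \<open>0\<close> by convention for the empty set.
  Likewise the real-valued suprema below are the genuine ones only for non-empty sets that are
  bounded above; this is the case for non-empty compact (indeed, bounded) arguments.\<close>

definition directed_dist :: "'a::metric_space set \<Rightarrow> 'a set \<Rightarrow> real" where
  "directed_dist A B = (SUP x\<in>A. infdist x B)"

definition hausdorff_dist :: "'a::metric_space set \<Rightarrow> 'a set \<Rightarrow> real" where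
  "hausdorff_dist A B = max (directed_dist A B) (directed_dist B A)"

definition lattice_point :: "real^'n \<Rightarrow> real \<Rightarrow> int^'n \<Rightarrow> real^'n" where
  "lattice_point p h j = p + h *\<^sub>R (\<chi> i. of_int (j $ i))"

definition grid_points :: "real^'n \<Rightarrow> real \<Rightarrow> int^'n \<Rightarrow> (real^'n) set" where
  "grid_points p h K = lattice_point p h ` {j. \<forall>i. 0 \<le> j $ i \<and> j $ i \<le> K $ i}"

text \<open>A cell is encoded by the index of its corner with the smallest coordinates; hence the
  strict upper bound.\<close>

definition grid_cells :: "int^'n \<Rightarrow> (int^'n) set" where
  "grid_cells K = {c. \<forall>i. 0 \<le> c $ i \<and> c $ i < K $ i}"

definition cell_corners :: "real^'n \<Rightarrow> real \<Rightarrow> int^'n \<Rightarrow> (real^'n) set" where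
  "cell_corners p h c = lattice_point p h ` {j. \<forall>i. j $ i = c $ i \<or> j $ i = c $ i + 1}"

definition grid_covers :: "real^'n \<Rightarrow> real \<Rightarrow> int^'n \<Rightarrow> (real^'n) set \<Rightarrow> bool" where
  "grid_covers p h K S \<longleftrightarrow>
     (\<forall>y\<in>S. \<exists>c\<in>grid_cells K. y \<in> convex hull (cell_corners p h c))"

definition grid_suitable :: "real^'n \<Rightarrow> real \<Rightarrow> int^'n \<Rightarrow> (real^'n) set \<Rightarrow> bool" where
  "grid_suitable p h K S \<longleftrightarrow>
     (\<forall>c\<in>grid_cells K. (\<forall>x\<in>cell_corners p h c. x \<notin> S) \<longrightarrow>
        convex hull (cell_corners p h c) \<inter> S = {})"

definition grid_hausdorff_dist ::
    "real^'n \<Rightarrow> real \<Rightarrow> int^'n \<Rightarrow> (real^'n) set \<Rightarrow> (real^'n) set \<Rightarrow> real" where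
  "grid_hausdorff_dist p h K A B =
     Max ((\<lambda>x. \<bar>infdist x A - infdist x B\<bar>) ` grid_points p h K)"

definition unit_cube :: "(real^'n) set" where
  "unit_cube = {y. \<forall>i. 0 \<le> y $ i \<and> y $ i \<le> 1}"

definition nonzero_cube_vertices :: "(real^'n) set" where
  "nonzero_cube_vertices = {x. \<forall>i. x $ i \<in> {0, 1}} - {0}"

text \<open>The dimension is that of the index type, passed as a type argument.\<close>

definition dim_const :: "'n::finite itself \<Rightarrow> real" where
  "dim_const _ =
     (SUP y\<in>(unit_cube :: (real^'n) set).
        min (norm y) (MIN x\<in>nonzero_cube_vertices. 2 * norm (x - y)))"

end

theory Submission
  imports Defs
begin

text \<open>Let \<open>y \<in> A\<close> lie in a cell, and let \<open>d\<close> be the grid distance. By suitability some corner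
  \<open>a\<close> of the cell belongs to \<open>A\<close>, and \<open>d\<^sub>B(y) \<le> |a - y| + d\<^sub>B(a) \<le> |a - y| + d\<close> because
  \<open>d\<^sub>A(a) = 0\<close>. Every other corner \<open>x\<close> satisfies
  \<open>d\<^sub>B(y) \<le> |x - y| + d\<^sub>B(x) \<le> |x - y| + d\<^sub>A(x) + d \<le> 2|x - y| + d\<close>. An affine map with
  coordinate reflections takes the cell to the unit cube and \<open>a\<close> to the origin, and scales
  distances by \<open>1/h\<close>; hence \<open>d\<^sub>B(y) - d\<close> is at most \<open>h\<close> times one of the minima whose supremum is
  the dimensional constant.\<close>

lemma finite_vec_componentwise:
  fixes S :: "'n::finite \<Rightarrow> 'a set"
  assumes "\<And>i. finite (S i)"
  shows "finite {x :: 'a^'n. \<forall>i. x $ i \<in> S i}"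
proof (rule finite_subset)
  show "finite (vec_lambda ` PiE UNIV S)"
    using assms by (intro finite_imageI finite_PiE) auto
  show "{x :: 'a^'n. \<forall>i. x $ i \<in> S i} \<subseteq> vec_lambda ` PiE UNIV S"
  proof
    fix x :: "'a^'n" assume "x \<in> {x. \<forall>i. x $ i \<in> S i}"
    then have "vec_nth x \<in> PiE UNIV S" by auto
    then have "vec_lambda (vec_nth x) \<in> vec_lambda ` PiE UNIV S" by (rule imageI)
    then show "x \<in> vec_lambda ` PiE UNIV S" by (simp add: vec_nth_inverse)
  qed
qed

text \<open>The norm ignores signs of coordinates; this is how the reflections in
  \<open>le_dim_const_cell\<close> are seen to preserve distances.\<close>

lemma norm_eq_componentwise:
  fixes a b :: "real^'n"
  assumes "\<And>i. \<bar>a $ i\<bar> = \<bar>b $ i\<bar>"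
  shows "norm a = norm b"
  using assms by (intro antisym norm_le_componentwise_cart) auto

lemma finite_grid_points: "finite (grid_points p h K)"
  using finite_vec_componentwise[of "\<lambda>i. {0..K $ i}"] by (simp add: grid_points_def)

lemma finite_nonzero_cube_vertices: "finite (nonzero_cube_vertices :: (real^'n) set)"
  using finite_vec_componentwise[of "\<lambda>_. {0, 1 :: real}"]
  by (simp add: nonzero_cube_vertices_def)

lemma nonzero_cube_vertices_nonempty: "(nonzero_cube_vertices :: (real^'n) set) \<noteq> {}"
proof -
  have "(1 :: real^'n) \<in> nonzero_cube_vertices"
    by (auto simp: nonzero_cube_vertices_def vec_eq_iff)
  then show ?thesis by blast
qed

lemma le_dim_const:
  fixes z :: "real^'n"
  assumes z: "z \<in> unit_cube" and "t \<le> norm z"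
    and "\<And>v. v \<in> nonzero_cube_vertices \<Longrightarrow> t \<le> 2 * norm (v - z)"
  shows "t \<le> dim_const TYPE('n)"
proof -
  let ?f = "\<lambda>y :: real^'n. min (norm y) (MIN x\<in>nonzero_cube_vertices. 2 * norm (x - y))"
  have "unit_cube = cbox (0 :: real^'n) 1"
    by (auto simp: unit_cube_def mem_box_cart)
  then obtain M where M: "\<And>y :: real^'n. y \<in> unit_cube \<Longrightarrow> norm y \<le> M"
    by (metis bounded_cbox bounded_iff)
  have "t \<le> ?f z"
    using assms by (auto simp: finite_nonzero_cube_vertices nonzero_cube_vertices_nonempty)
  also have "\<dots> \<le> dim_const TYPE('n)"
    unfolding dim_const_def
  proof (rule cSUP_upper[OF z])
    \<comment> \<open>The minimum is at most \<open>norm y\<close>, which is bounded on the cube.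
      Without an upper bound the real-valued \<open>SUP\<close> need not dominate the value at
      \<open>z\<close>.\<close>
    show "bdd_above (?f ` unit_cube)"
      by (rule bdd_aboveI2[where M = M]) (use M in \<open>auto intro: min.coboundedI1\<close>)
  qed
  finally show ?thesis .
qed

text \<open>The box with these bounds is convex and contains all corners, hence also their
  hull.\<close>

lemma convex_hull_cell_corners_bounds:
  assumes "h > 0" and "y \<in> convex hull (cell_corners p h c)"
  shows "p $ i + h * of_int (c $ i) \<le> y $ i" "y $ i \<le> p $ i + h * (of_int (c $ i) + 1)"
proof -
  let ?l = "\<chi> i. p $ i + h * of_int (c $ i)" and ?u = "\<chi> i. p $ i + h * (of_int (c $ i) + 1)"
  have "lattice_point p h j \<in> cbox ?l ?u" if j: "\<forall>i. j $ i = c $ i \<or> j $ i = c $ i + 1" for j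
  proof -
    have "p $ i + h * of_int (c $ i) \<le> p $ i + h * of_int (j $ i) \<and>
        p $ i + h * of_int (j $ i) \<le> p $ i + h * (of_int (c $ i) + 1)" for i
      using j[rule_format, of i] \<open>h > 0\<close> by (auto simp: algebra_simps)
    then show ?thesis by (simp add: mem_box_cart lattice_point_def)
  qed
  then have "convex hull (cell_corners p h c) \<subseteq> cbox ?l ?u"
    by (intro hull_minimal convex_box) (auto simp: cell_corners_def)
  with assms(2) have "y \<in> cbox ?l ?u" by blast
  then show "p $ i + h * of_int (c $ i) \<le> y $ i" "y $ i \<le> p $ i + h * (of_int (c $ i) + 1)"
    by (simp_all add: mem_box_cart)
qed

lemma cell_corners_subset_grid_points:
  assumes "c \<in> grid_cells K"
  shows "cell_corners p h c \<subseteq> grid_points p h K"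
  unfolding cell_corners_def grid_points_def
proof (rule image_mono, clarify)
  fix j i
  assume "\<forall>i. j $ i = c $ i \<or> j $ i = c $ i + 1"
  then have "j $ i = c $ i \<or> j $ i = c $ i + 1" by blast
  moreover have "0 \<le> c $ i \<and> c $ i < K $ i"
    using assms by (simp add: grid_cells_def)
  \<comment> \<open>The strict bound on cell indices absorbs the extra 1 of an upper corner.\<close>
  ultimately show "0 \<le> j $ i \<and> j $ i \<le> K $ i" by linarith
qed

text \<open>Rescaled form of \<open>le_dim_const\<close>: the distinguished corner \<open>a\<close>
  plays the role of the origin, whichever corner of the cell it is.\<close>

lemma le_dim_const_cell:
  fixes p y :: "real^'n"
  assumes h: "h > 0" and y: "y \<in> convex hull (cell_corners p h c)"
    and a: "a \<in> cell_corners p h c" "t \<le> norm (a - y)"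
    and t: "\<And>x. x \<in> cell_corners p h c \<Longrightarrow> t \<le> 2 * norm (x - y)"
  shows "t \<le> dim_const TYPE('n) * h"
proof -
  obtain k where k: "\<And>i. k $ i = c $ i \<or> k $ i = c $ i + 1" and ak: "a = lattice_point p h k"
    using a(1) by (auto simp: cell_corners_def)
  \<comment> \<open>\<open>s i\<close> is the direction along axis \<open>i\<close> that leads from
    \<open>a\<close> into the cell, so the coordinates \<open>z\<close> of \<open>y\<close> relative
    to \<open>a\<close> are nonnegative.\<close>
  define s :: "'n \<Rightarrow> int" where "s i = (if k $ i = c $ i then 1 else -1)" for i
  define z :: "real^'n" where "z = (\<chi> i. of_int (s i) * (y $ i - a $ i) / h)"
  have abs_s: "\<bar>of_int (s i) :: real\<bar> = 1" for i by (simp add: s_def)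
  \<comment> \<open>Each reflection is its own inverse, which recovers \<open>y\<close> from
    \<open>z\<close>.\<close>
  have ss: "of_int (s i) * (of_int (s i) * r) = (r :: real)" for i r by (simp add: s_def)
  have ya: "y $ i - a $ i = h * (of_int (s i) * z $ i)" for i
    using h by (simp add: z_def ss)
  have zc: "z \<in> unit_cube"
  proof -
    have "0 \<le> z $ i \<and> z $ i \<le> 1" for i
      using convex_hull_cell_corners_bounds[OF h y, of i] k[of i] h
      by (auto simp: z_def s_def ak lattice_point_def field_simps)
    then show ?thesis by (simp add: unit_cube_def)
  qed
  have "norm (a - y) = norm (h *\<^sub>R z)"
  proof (rule norm_eq_componentwise)
    show "\<bar>(a - y) $ i\<bar> = \<bar>(h *\<^sub>R z) $ i\<bar>" for i
      using ya[of i] abs_s[of i] by (simp add: abs_minus_commute[of "a $ i"] abs_mult)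
  qed
  then have "t / h \<le> norm z"
    using a(2) h by (simp add: field_simps)
  moreover have "t / h \<le> 2 * norm (v - z)" if v: "v \<in> nonzero_cube_vertices" for v
  proof -
    \<comment> \<open>The corner that the normalisation sends to \<open>v\<close>: one step from
      \<open>a\<close> into the cell along each axis where \<open>v\<close> is 1.\<close>
    define j where "j = (\<chi> i. if v $ i = 0 then k $ i else k $ i + s i)"
    have v01: "v $ i = 0 \<or> v $ i = 1" for i
      using v by (auto simp: nonzero_cube_vertices_def)
    have "j $ i = c $ i \<or> j $ i = c $ i + 1" for i
      using k[of i] by (auto simp: j_def s_def)
    then have "lattice_point p h j \<in> cell_corners p h c"
      by (auto simp: cell_corners_def)
    then have "t \<le> 2 * norm (lattice_point p h j - y)" by (rule t)
    also have "norm (lattice_point p h j - y) = norm (h *\<^sub>R (v - z))"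
    proof (rule norm_eq_componentwise)
      fix i
      have "lattice_point p h j $ i - a $ i = h * (of_int (s i) * v $ i)"
        using v01[of i] by (auto simp: ak lattice_point_def j_def algebra_simps)
      then have "(lattice_point p h j - y) $ i = h * (of_int (s i) * (v $ i - z $ i))"
        using ya[of i] by (simp add: algebra_simps)
      then show "\<bar>(lattice_point p h j - y) $ i\<bar> = \<bar>(h *\<^sub>R (v - z)) $ i\<bar>"
        using abs_s[of i] by (simp add: abs_mult)
    qed
    also have "\<dots> = h * norm (v - z)" using h by simp
    finally show ?thesis
      using h by (simp add: field_simps)
  qed
  ultimately have "t / h \<le> dim_const TYPE('n)"
    by (rule le_dim_const[OF zc])
  then show ?thesis
    using h by (simp add: field_simps)
qed

lemma abs_infdist_diff_le_grid_hausdorff_dist: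
  assumes "x \<in> grid_points p h K"
  shows "\<bar>infdist x A - infdist x B\<bar> \<le> grid_hausdorff_dist p h K A B"
  unfolding grid_hausdorff_dist_def using assms by (intro Max_ge) (auto simp: finite_grid_points)

lemma grid_hausdorff_dist_commute:
  "grid_hausdorff_dist p h K A B = grid_hausdorff_dist p h K B A"
  by (simp add: grid_hausdorff_dist_def abs_minus_commute)

lemma directed_dist_le:
  fixes A B :: "(real^'n) set"
  assumes "A \<noteq> {}" and h: "h > 0"
    and covers: "grid_covers p h K A" and suitable: "grid_suitable p h K A"
  shows "directed_dist A B \<le> grid_hausdorff_dist p h K A B + dim_const TYPE('n) * h"
  unfolding directed_dist_def
proof (rule cSUP_least[OF \<open>A \<noteq> {}\<close>])
  fix y assume y: "y \<in> A"
  let ?d = "grid_hausdorff_dist p h K A B"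
  obtain c where c: "c \<in> grid_cells K" and yc: "y \<in> convex hull (cell_corners p h c)"
    using covers y by (auto simp: grid_covers_def)
  \<comment> \<open>Contrapositive of suitability: \<open>y\<close> lies in both the hull and
    \<open>A\<close>.\<close>
  then obtain a where a: "a \<in> cell_corners p h c" "a \<in> A"
    using suitable y unfolding grid_suitable_def by blast
  \<comment> \<open>One estimate serves both cases: \<open>infdist x A\<close> vanishes at
    \<open>x = a\<close>, and at any corner it is at most \<open>norm (x - y)\<close> because
    \<open>y\<close> is in \<open>A\<close>.\<close>
  have corner: "infdist y B \<le> norm (x - y) + infdist x A + ?d" if "x \<in> cell_corners p h c" for x
  proof -
    have "x \<in> grid_points p h K"
      using that cell_corners_subset_grid_points[OF c] by blast
    from abs_infdist_diff_le_grid_hausdorff_dist[OF this, of A B]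
    show ?thesis
      using infdist_triangle[of y B x] by (simp add: dist_norm norm_minus_commute)
  qed
  have "infdist y B - ?d \<le> dim_const TYPE('n) * h"
  proof (rule le_dim_const_cell[OF h yc a(1)])
    show "infdist y B - ?d \<le> norm (a - y)"
      using corner[OF a(1)] a(2) by simp
    fix x assume "x \<in> cell_corners p h c"
    from corner[OF this] show "infdist y B - ?d \<le> 2 * norm (x - y)"
      using infdist_le[OF y, of x] by (simp add: dist_norm)
  qed
  then show "infdist y B \<le> ?d + dim_const TYPE('n) * h" by simp
qed

theorem corollary2:
  fixes A B :: "(real^'n) set" and p :: "real^'n" and h :: real and K :: "int^'n"
  assumes "A \<noteq> {}" and "compact A"
    and "B \<noteq> {}" and "compact B"
    and "h > 0" and "\<forall>i. K $ i \<ge> 1"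
    and "grid_covers p h K (A \<union> B)"
    and "grid_suitable p h K A" and "grid_suitable p h K B"
  shows "hausdorff_dist A B - grid_hausdorff_dist p h K A B \<le> dim_const TYPE('n) * h"
proof -
  have "grid_covers p h K A" "grid_covers p h K B"
    using assms(7) by (auto simp: grid_covers_def)
  then show ?thesis
    using directed_dist_le[of A h p K B] directed_dist_le[of B h p K A] assms
    by (simp add: hausdorff_dist_def grid_hausdorff_dist_commute[of p h K B A])
qed

end
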